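(* Let $X$ be an Archimedean vector lattice and let $\varphi$ be a linear functional on $X$. Then $\varphi$ is order bounded if and only if $\ker\varphi$ is uniformly closed in $X$.
   Context: Vector lattices are over $\mathbb R$. For $e\in X_+$, $I_e$ is the principal ideal generated by $e$, with the norm $\|x\|_e=\inf\{\lambda>0 : |x|\le\lambda e\}$. A net $(x_\alpha)$ in $X$ converges (relatively) uniformly to $x\in X$ if there is $e\in X_+$ with $\|x_\alpha-x\|_e\to 0$ (in particular, $x_\alpha-x\in I_e$ for all sufficiently large $\alpha$). A subset $A\subseteq X$ is uniformly closed if it is closed with respect to uniform convergence; equivalently, $A\cap I_e$ is closed in $(I_e,\|\cdot\|_e)$ for every $e\in X_+$. *)

theory Defs
  imports "HOL-Analysis.Analysis" "HOL-Library.Lattice_Algebras"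
begin

class vector_lattice = ordered_real_vector + lattice_ab_group_add_abs

class archimedean_vector_lattice = vector_lattice +
  assumes archimedean: "(\<forall>n::nat. real n *\<^sub>R x \<le> y) \<Longrightarrow> x \<le> 0"

instance real :: archimedean_vector_lattice
proof
  fix x y :: real
  show "x \<le> 0" if "\<forall>n::nat. real n *\<^sub>R x \<le> y"
    using that by (metis real_scaleR_def reals_Archimedean3 not_le)
qed

definition principal_ideal :: "'a::vector_lattice \<Rightarrow> 'a set" where
  "principal_ideal e = {x. \<exists>c\<ge>0. \<bar>x\<bar> \<le> c *\<^sub>R e}"

text \<open>Only meaningful for \<open>x \<in> principal_ideal e\<close>: otherwise the set is empty and its infimum is
  unspecified.\<close>

definition ideal_norm :: "'a::vector_lattice \<Rightarrow> 'a \<Rightarrow> real" where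
  "ideal_norm e x = Inf {c. 0 < c \<and> \<bar>x\<bar> \<le> c *\<^sub>R e}"

text \<open>As usual in Isabelle/HOL, a net is a function on its index type together with the filter
  generated by the tails of the index set.\<close>

definition uniformly_tendsto :: "('i \<Rightarrow> 'a::vector_lattice) \<Rightarrow> 'a \<Rightarrow> 'i filter \<Rightarrow> bool" where
  "uniformly_tendsto f x F \<longleftrightarrow>
    (\<exists>e\<ge>0. (\<forall>\<^sub>F i in F. f i - x \<in> principal_ideal e) \<and>
           ((\<lambda>i. ideal_norm e (f i - x)) \<longlongrightarrow> 0) F)"

text \<open>A definition cannot quantify over the index types of all nets. It suffices to quantify over the
  image filters on the space itself; \<open>uniformly_closedD\<close> below recovers all index types.\<close>

definition uniformly_closed :: "'a::vector_lattice set \<Rightarrow> bool" where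
  "uniformly_closed A \<longleftrightarrow>
    (\<forall>F x. F \<noteq> bot \<and> (\<forall>\<^sub>F y in F. y \<in> A) \<and> uniformly_tendsto (\<lambda>y. y) x F \<longrightarrow> x \<in> A)"

lemma uniformly_closedD:
  fixes f :: "'i \<Rightarrow> 'a::vector_lattice"
  assumes "uniformly_closed A" "F \<noteq> bot" "\<forall>\<^sub>F i in F. f i \<in> A" "uniformly_tendsto f x F"
  shows "x \<in> A"
proof -
  have "uniformly_tendsto (\<lambda>y. y) x (filtermap f F)"
    using assms(4) by (simp add: uniformly_tendsto_def eventually_filtermap filterlim_filtermap)
  moreover have "filtermap f F \<noteq> bot" "\<forall>\<^sub>F y in filtermap f F. y \<in> A"
    using assms(2,3) by (simp_all add: filtermap_bot_iff eventually_filtermap)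
  ultimately show ?thesis
    using assms(1) unfolding uniformly_closed_def by blast
qed

lemma diff_in_principal_ideal:
  assumes "x \<in> principal_ideal e" "y \<in> principal_ideal e"
  shows "x - y \<in> principal_ideal e"
proof -
  obtain c d where c: "c \<ge> 0" "\<bar>x\<bar> \<le> c *\<^sub>R e" and d: "d \<ge> 0" "\<bar>y\<bar> \<le> d *\<^sub>R e"
    using assms by (auto simp: principal_ideal_def)
  have "\<bar>x - y\<bar> \<le> \<bar>x\<bar> + \<bar>y\<bar>"
    by (rule abs_triangle_ineq4)
  also have "\<dots> \<le> (c + d) *\<^sub>R e"
    using c d by (simp add: scaleR_add_left add_mono)
  finally show ?thesis
    using c d by (auto simp: principal_ideal_def intro!: exI[of _ "c + d"])
qed

lemma principal_ideal_mono:
  assumes "e \<le> e'"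
  shows "principal_ideal e \<subseteq> principal_ideal e'"
  unfolding principal_ideal_def
  using scaleR_left_mono[OF assms] by (blast intro: order_trans)

lemma self_in_principal_ideal: "\<bar>x\<bar> \<le> e \<Longrightarrow> x \<in> principal_ideal e"
  by (auto simp: principal_ideal_def intro!: exI[of _ 1])

lemma ideal_norm_witnesses:
  assumes "0 \<le> e" "x \<in> principal_ideal e"
  shows "{c. 0 < c \<and> \<bar>x\<bar> \<le> c *\<^sub>R e} \<noteq> {}"
proof -
  obtain c where c: "c \<ge> 0" "\<bar>x\<bar> \<le> c *\<^sub>R e"
    using assms(2) by (auto simp: principal_ideal_def)
  have "\<bar>x\<bar> \<le> (c + 1) *\<^sub>R e"
    using c(2) by (rule order_trans) (simp add: assms(1) scaleR_right_mono)
  then show ?thesis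
    using c(1) by (auto intro!: exI[of _ "c + 1"])
qed

lemma ideal_norm_nonneg:
  assumes "0 \<le> e" "x \<in> principal_ideal e"
  shows "0 \<le> ideal_norm e x"
  unfolding ideal_norm_def
  by (rule cInf_greatest) (use ideal_norm_witnesses[OF assms] in auto)

lemma ideal_norm_antimono:
  assumes "0 \<le> e" "e \<le> e'" "x \<in> principal_ideal e"
  shows "ideal_norm e' x \<le> ideal_norm e x"
  unfolding ideal_norm_def
proof (rule cInf_superset_mono)
  show "{c. 0 < c \<and> \<bar>x\<bar> \<le> c *\<^sub>R e} \<noteq> {}"
    using ideal_norm_witnesses assms by blast
  show "bdd_below {c. 0 < c \<and> \<bar>x\<bar> \<le> c *\<^sub>R e'}"
    by (auto intro: bdd_belowI[of _ 0])
  show "{c. 0 < c \<and> \<bar>x\<bar> \<le> c *\<^sub>R e} \<subseteq> {c. 0 < c \<and> \<bar>x\<bar> \<le> c *\<^sub>R e'}"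
    using scaleR_left_mono[OF assms(2)] by (blast intro: order_trans less_imp_le)
qed

lemma uniformly_closed_iff_principal_ideals:
  "uniformly_closed A \<longleftrightarrow>
    (\<forall>e\<ge>0. \<forall>x\<in>principal_ideal e.
      (\<forall>\<epsilon>>0. \<exists>a\<in>A \<inter> principal_ideal e. ideal_norm e (a - x) < \<epsilon>) \<longrightarrow> x \<in> A)"
  (is "_ \<longleftrightarrow> ?R")
proof
  assume A: "uniformly_closed A"
  show ?R
  proof (intro allI ballI impI)
    fix e x :: 'a
    assume e: "0 \<le> e" and x: "x \<in> principal_ideal e"
      and "\<forall>\<epsilon>>0. \<exists>a\<in>A \<inter> principal_ideal e. ideal_norm e (a - x) < \<epsilon>"
    then have "\<forall>n::nat. \<exists>a\<in>A \<inter> principal_ideal e. ideal_norm e (a - x) < inverse (real (Suc n))"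
      by simp
    then obtain a where a: "\<And>n. a n \<in> A" "\<And>n. a n \<in> principal_ideal e"
      "\<And>n. ideal_norm e (a n - x) < inverse (real (Suc n))"
      by (metis IntE)
    have I: "a n - x \<in> principal_ideal e" for n
      using a(2) x by (rule diff_in_principal_ideal)
    have "(\<lambda>n. ideal_norm e (a n - x)) \<longlonglongrightarrow> 0"
      by (rule tendsto_sandwich[OF _ _ tendsto_const LIMSEQ_inverse_real_of_nat])
        (auto intro!: always_eventually ideal_norm_nonneg e I less_imp_le[OF a(3), simplified])
    then have "uniformly_tendsto a x sequentially"
      using e I unfolding uniformly_tendsto_def by (intro exI[of _ e]) auto
    then show "x \<in> A"
      using uniformly_closedD[OF A, of sequentially a x] a(1) by simp
  qed
next
  assume R: ?R
  show "uniformly_closed A"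
    unfolding uniformly_closed_def
  proof (intro allI impI, elim conjE)
    fix F :: "'a filter" and x
    assume F: "F \<noteq> bot" and FA: "\<forall>\<^sub>F y in F. y \<in> A" and "uniformly_tendsto (\<lambda>y. y) x F"
    then obtain e where e: "0 \<le> e" and I: "\<forall>\<^sub>F y in F. y - x \<in> principal_ideal e"
      and lim: "((\<lambda>y. ideal_norm e (y - x)) \<longlongrightarrow> 0) F"
      by (auto simp: uniformly_tendsto_def)
    let ?e = "e + \<bar>x\<bar>"
    have ee: "e \<le> ?e" "0 \<le> ?e" using e by simp_all
    have x: "x \<in> principal_ideal ?e" "- x \<in> principal_ideal ?e"
      using e by (auto intro!: self_in_principal_ideal)
    have "\<exists>a\<in>A \<inter> principal_ideal ?e. ideal_norm ?e (a - x) < \<epsilon>" if "\<epsilon> > 0" for \<epsilon>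
    proof -
      have "\<forall>\<^sub>F y in F. ideal_norm e (y - x) < \<epsilon>"
        using lim that by (rule order_tendstoD(2))
      then have "\<forall>\<^sub>F y in F. ideal_norm e (y - x) < \<epsilon> \<and> y - x \<in> principal_ideal e \<and> y \<in> A"
        using I FA by eventually_elim auto
      then obtain y where y: "ideal_norm e (y - x) < \<epsilon>" "y - x \<in> principal_ideal e" "y \<in> A"
        using F eventually_happens' by blast
      have "y - x \<in> principal_ideal ?e"
        using y(2) principal_ideal_mono[OF ee(1)] by blast
      from diff_in_principal_ideal[OF this x(2)] have "y \<in> principal_ideal ?e"
        by simp
      moreover have "ideal_norm ?e (y - x) < \<epsilon>"
        using ideal_norm_antimono[OF e ee(1) y(2)] y(1) by simp
      ultimately show ?thesis using y(3) by blast
    qed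
    then show "x \<in> A" using R ee(2) x(1) by blast
  qed
qed

definition order_bounded_set :: "'a::ord set \<Rightarrow> bool" where
  "order_bounded_set B \<longleftrightarrow> (\<exists>a b. B \<subseteq> {a..b})"

definition order_bounded_functional :: "('a::vector_lattice \<Rightarrow> real) \<Rightarrow> bool" where
  "order_bounded_functional \<phi> \<longleftrightarrow>
    (\<forall>B. order_bounded_set B \<longrightarrow> order_bounded_set (\<phi> ` B))"

end

theory Submission
  imports Defs
begin

text \<open>Both properties are statements about the restrictions of \<open>\<phi>\<close> to the principal ideals. Order
  boundedness says that \<open>\<phi>\<close> is bounded on \<open>{y. \<bar>y\<bar> \<le> e}\<close> for every \<open>e \<ge> 0\<close>
  (\<open>order_bounded_functional_iff\<close>), hence that its restriction to \<open>principal_ideal e\<close> is continuous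
  for \<open>ideal_norm e\<close>; by \<open>uniformly_closed_iff_ideal_approx\<close>, a uniformly closed kernel is one whose
  trace on each \<open>principal_ideal e\<close> is closed for that norm. So the theorem reduces to the classical
  fact that a linear functional is continuous if and only if its kernel is closed: if \<open>\<phi>\<close> is unbounded
  on \<open>{y. \<bar>y\<bar> \<le> e}\<close>, then for each \<open>u \<in> principal_ideal e\<close> the elements
  \<open>u - (\<phi> u / \<phi> y) *\<^sub>R y\<close> of the kernel, with \<open>\<bar>y\<bar> \<le> e\<close> and \<open>\<bar>\<phi> y\<bar>\<close> large, approximate
  \<open>u\<close>, so a closed kernel contains all of \<open>principal_ideal e\<close>, contradicting the
  unboundedness.\<close>

lemma abs_scaleR_le:
  fixes y e :: "'a::vector_lattice"
  assumes "\<bar>y\<bar> \<le> e"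
  shows "\<bar>c *\<^sub>R y\<bar> \<le> \<bar>c\<bar> *\<^sub>R e"
proof -
  have y: "y \<le> e" "- y \<le> e"
    using assms abs_ge_self[of y] abs_ge_minus_self[of y] by (blast intro: order_trans)+
  show ?thesis
  proof (cases "0 \<le> c")
    case True
    then show ?thesis
      using scaleR_left_mono[OF y(1), of c] scaleR_left_mono[OF y(2), of c]
      by (intro abs_leI) auto
  next
    case False
    then show ?thesis
      using scaleR_left_mono[OF y(1), of "- c"] scaleR_left_mono[OF y(2), of "- c"]
      by (intro abs_leI) auto
  qed
qed

lemma scaleR_in_principal_ideal: "\<bar>y\<bar> \<le> e \<Longrightarrow> c *\<^sub>R y \<in> principal_ideal e"
  using abs_scaleR_le[of y e c] by (auto simp: principal_ideal_def intro!: exI[of _ "\<bar>c\<bar>"])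

lemma ideal_norm_less_iff:
  assumes "0 \<le> e" "x \<in> principal_ideal e"
  shows "ideal_norm e x < \<epsilon> \<longleftrightarrow> (\<exists>c>0. c < \<epsilon> \<and> \<bar>x\<bar> \<le> c *\<^sub>R e)"
  unfolding ideal_norm_def
  by (subst cInf_less_iff) (use ideal_norm_witnesses[OF assms] in \<open>auto intro: bdd_belowI[of _ 0]\<close>)

text \<open>The characterisation of uniformly closed sets by principal ideals, with the norm eliminated.\<close>

lemma uniformly_closed_iff_ideal_approx:
  "uniformly_closed A \<longleftrightarrow>
    (\<forall>e\<ge>0. \<forall>x\<in>principal_ideal e.
      (\<forall>\<epsilon>>0. \<exists>a\<in>A \<inter> principal_ideal e. \<exists>c>0. c < \<epsilon> \<and> \<bar>a - x\<bar> \<le> c *\<^sub>R e) \<longrightarrow> x \<in> A)"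
proof -
  have "(\<exists>a\<in>A \<inter> principal_ideal e. ideal_norm e (a - x) < \<epsilon>) \<longleftrightarrow>
      (\<exists>a\<in>A \<inter> principal_ideal e. \<exists>c>0. c < \<epsilon> \<and> \<bar>a - x\<bar> \<le> c *\<^sub>R e)"
    if "0 \<le> e" "x \<in> principal_ideal e" for e x :: 'a and \<epsilon>
    using that by (intro bex_cong refl ideal_norm_less_iff diff_in_principal_ideal) auto
  then show ?thesis
    unfolding uniformly_closed_iff_principal_ideals by simp
qed

lemma order_bounded_functional_iff:
  fixes \<phi> :: "'a::vector_lattice \<Rightarrow> real"
  assumes "linear \<phi>"
  shows "order_bounded_functional \<phi> \<longleftrightarrow> (\<forall>e\<ge>0. \<exists>M. \<forall>y. \<bar>y\<bar> \<le> e \<longrightarrow> \<bar>\<phi> y\<bar> \<le> M)"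
proof
  assume bdd: "order_bounded_functional \<phi>"
  show "\<forall>e\<ge>0. \<exists>M. \<forall>y. \<bar>y\<bar> \<le> e \<longrightarrow> \<bar>\<phi> y\<bar> \<le> M"
  proof (intro allI impI)
    fix e :: 'a
    have "order_bounded_set {- e..e}"
      by (auto simp: order_bounded_set_def)
    then obtain l u where lu: "\<phi> ` {- e..e} \<subseteq> {l..u}"
      using bdd by (force simp: order_bounded_functional_def order_bounded_set_def[of "\<phi> ` _"])
    have "\<bar>\<phi> y\<bar> \<le> max \<bar>l\<bar> \<bar>u\<bar>" if "\<bar>y\<bar> \<le> e" for y
    proof -
      have "y \<le> e" "- y \<le> e"
        using that abs_ge_self[of y] abs_ge_minus_self[of y] by (blast intro: order_trans)+
      then have "y \<in> {- e..e}"
        using minus_le_iff by auto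
      then have "\<phi> y \<in> {l..u}"
        using lu by blast
      then show ?thesis by auto
    qed
    then show "\<exists>M. \<forall>y. \<bar>y\<bar> \<le> e \<longrightarrow> \<bar>\<phi> y\<bar> \<le> M" by blast
  qed
next
  assume bdd: "\<forall>e\<ge>0. \<exists>M. \<forall>y. \<bar>y\<bar> \<le> e \<longrightarrow> \<bar>\<phi> y\<bar> \<le> M"
  show "order_bounded_functional \<phi>"
    unfolding order_bounded_functional_def
  proof (intro allI impI)
    fix B :: "'a set"
    assume "order_bounded_set B"
    then obtain a b where B: "B \<subseteq> {a..b}"
      by (auto simp: order_bounded_set_def)
    show "order_bounded_set (\<phi> ` B)"
    proof (cases "a \<le> b")
      case True
      then obtain M where M: "\<And>y. \<bar>y\<bar> \<le> b - a \<Longrightarrow> \<bar>\<phi> y\<bar> \<le> M"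
        using bdd[rule_format, of "b - a"] by auto
      have "\<phi> y \<in> {\<phi> a - M..\<phi> a + M}" if "y \<in> B" for y
      proof -
        have y: "a \<le> y" "y \<le> b"
          using that B by auto
        then have "\<bar>y - a\<bar> \<le> b - a"
          by (simp add: abs_of_nonneg diff_right_mono)
        then have "\<bar>\<phi> y - \<phi> a\<bar> \<le> M"
          using M[of "y - a"] linear_diff[OF assms] by simp
        then show ?thesis by auto
      qed
      then show ?thesis
        unfolding order_bounded_set_def by blast
    next
      case False
      then have "B = {}"
        using B by auto
      then show ?thesis
        by (simp add: order_bounded_set_def)
    qed
  qed
qed

lemma uniformly_closed_kernel:
  fixes \<phi> :: "'a::vector_lattice \<Rightarrow> real"
  assumes lin: "linear \<phi>" and bdd: "order_bounded_functional \<phi>"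
  shows "uniformly_closed {x. \<phi> x = 0}"
  unfolding uniformly_closed_iff_ideal_approx
proof (intro allI ballI impI)
  fix e x :: 'a
  assume e: "0 \<le> e"
    and approx: "\<forall>\<epsilon>>0. \<exists>a\<in>{x. \<phi> x = 0} \<inter> principal_ideal e. \<exists>c>0. c < \<epsilon> \<and> \<bar>a - x\<bar> \<le> c *\<^sub>R e"
  obtain M where M: "\<And>y. \<bar>y\<bar> \<le> e \<Longrightarrow> \<bar>\<phi> y\<bar> \<le> M"
    using bdd e unfolding order_bounded_functional_iff[OF lin] by blast
  have M0: "0 \<le> M"
    using M[of 0] e by simp
  have "\<bar>\<phi> x\<bar> \<le> 0 + \<delta>" if "0 < \<delta>" for \<delta>
  proof -
    have "0 < \<delta> / (M + 1)"
      using that M0 by simp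
    then obtain a c where a: "\<phi> a = 0" and c: "0 < c" "c < \<delta> / (M + 1)" "\<bar>a - x\<bar> \<le> c *\<^sub>R e"
      using approx by blast
    have "\<bar>inverse c *\<^sub>R (a - x)\<bar> \<le> e"
      using abs_scaleR_le[OF c(3), of "inverse c"] c(1) by simp
    then have "\<bar>inverse c * (\<phi> a - \<phi> x)\<bar> \<le> M"
      using M[of "inverse c *\<^sub>R (a - x)"] lin by (simp add: linear_scale linear_diff)
    then have "\<bar>\<phi> x\<bar> \<le> c * M"
      using a c(1) by (simp add: abs_mult field_simps)
    also have "\<dots> \<le> c * (M + 1)"
      using c(1) by simp
    also have "\<dots> \<le> \<delta>"
      using c(2) M0 by (simp add: field_simps)
    finally show ?thesis by simp
  qed
  then have "\<bar>\<phi> x\<bar> \<le> 0"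
    by (rule field_le_epsilon)
  then show "x \<in> {x. \<phi> x = 0}" by simp
qed

lemma order_bounded_of_uniformly_closed_kernel:
  fixes \<phi> :: "'a::vector_lattice \<Rightarrow> real"
  assumes lin: "linear \<phi>" and closed: "uniformly_closed {x. \<phi> x = 0}"
  shows "order_bounded_functional \<phi>"
proof (rule ccontr)
  assume "\<not> order_bounded_functional \<phi>"
  then obtain e where e: "0 \<le> e" and unbdd: "\<And>M. \<exists>y. \<bar>y\<bar> \<le> e \<and> M < \<bar>\<phi> y\<bar>"
    unfolding order_bounded_functional_iff[OF lin] by (auto simp: not_le)
  obtain u where u: "\<bar>u\<bar> \<le> e" "0 < \<bar>\<phi> u\<bar>"
    using unbdd[of 0] by blast
  have "\<exists>a\<in>{x. \<phi> x = 0} \<inter> principal_ideal e. \<exists>c>0. c < \<epsilon> \<and> \<bar>a - u\<bar> \<le> c *\<^sub>R e"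
    if "0 < \<epsilon>" for \<epsilon>
  proof -
    \<comment> \<open>Subtracting the multiple of \<open>y\<close> that carries the value \<open>\<phi> u\<close> projects \<open>u\<close> onto the kernel;
      the displacement has norm at most \<open>\<bar>\<phi> u / \<phi> y\<bar>\<close>.\<close>
    obtain y where y: "\<bar>y\<bar> \<le> e" "\<bar>\<phi> u\<bar> / \<epsilon> < \<bar>\<phi> y\<bar>"
      using unbdd by blast
    have "0 < \<bar>\<phi> u\<bar> / \<epsilon>"
      using u(2) that by simp
    then have y0: "\<phi> y \<noteq> 0"
      using y(2) by auto
    define t where "t = \<phi> u / \<phi> y"
    have "0 < \<bar>t\<bar>"
      using u(2) y0 by (simp add: t_def)
    moreover have "\<bar>t\<bar> < \<epsilon>"
      using y(2) y0 that by (simp add: t_def field_simps)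
    moreover have "\<phi> (u - t *\<^sub>R y) = 0"
      using y0 lin by (simp add: linear_diff linear_scale t_def)
    moreover have "u - t *\<^sub>R y \<in> principal_ideal e"
      using u(1) y(1)
      by (intro diff_in_principal_ideal self_in_principal_ideal scaleR_in_principal_ideal)
    moreover have "\<bar>u - t *\<^sub>R y - u\<bar> \<le> \<bar>t\<bar> *\<^sub>R e"
      using abs_scaleR_le[OF y(1), of t] by simp
    ultimately show ?thesis by blast
  qed
  then have "\<phi> u = 0"
    using closed e self_in_principal_ideal[OF u(1)]
    unfolding uniformly_closed_iff_ideal_approx by blast
  then show False
    using u(2) by simp
qed

theorem proposition4p1:
  fixes \<phi> :: "'a::archimedean_vector_lattice \<Rightarrow> real"
  assumes "linear \<phi>"
  shows "order_bounded_functional \<phi> \<longleftrightarrow> uniformly_closed {x. \<phi> x = 0}"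
  using assms uniformly_closed_kernel order_bounded_of_uniformly_closed_kernel by blast

end
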